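(* Let $R=K[x_1,\dots,x_n]$ be a polynomial ring over a field $K$ and let $I,J\subset R$ be polymatroidal monomial ideals. Then the product $IJ$ is polymatroidal.
   Context: For a monomial ideal $I\subset R$, $G(I)$ denotes its unique minimal set of monomial generators. For a monomial $u=x_1^{a_1}\cdots x_n^{a_n}$ set $\nu_i(u)=a_i$. A monomial ideal $I\subset R$ is polymatroidal if all elements of $G(I)$ have the same degree and the following exchange property holds: for all $u,v\in G(I)$ and all $i$ with $\nu_i(u)>\nu_i(v)$, there exists an integer $j$ with $\nu_j(v)>\nu_j(u)$ such that $x_j(u/x_i)\in G(I)$. *)

theory Defs
  imports Complex_Main "HOL-Library.Poly_Mapping"
begin

text \<open>
  Ideals of a commutative ring are the submodules of the ring over itself: \<open>ideal.subspace I\<close>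
  says that \<open>I\<close> is an ideal and \<open>ideal.span S\<close> is the ideal generated by \<open>S\<close>.
\<close>

global_interpretation ideal: module "(*) :: 'a::comm_ring_1 \<Rightarrow> 'a \<Rightarrow> 'a"
  by standard (simp_all add: algebra_simps)

definition ideal_prod :: "'a::comm_ring_1 set \<Rightarrow> 'a set \<Rightarrow> 'a set" where
  "ideal_prod I J = ideal.span {f * g | f g. f \<in> I \<and> g \<in> J}"

text \<open>
  The variables of $K[x_1,\dots,x_n]$ are indexed by a finite type \<open>'n\<close> with \<open>n\<close> elements, and
  an exponent vector \<open>u :: 'n \<Rightarrow>\<^sub>0 nat\<close> stands for the monomial with \<open>\<nu>\<^sub>i(u) = lookup u i\<close>.
  Multiplication of monomials is addition of exponent vectors.
\<close>

type_synonym ('n, 'k) mpoly = "('n \<Rightarrow>\<^sub>0 nat) \<Rightarrow>\<^sub>0 'k"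

definition monomial :: "('n::finite \<Rightarrow>\<^sub>0 nat) \<Rightarrow> ('n, 'k::field) mpoly" where
  "monomial u = Poly_Mapping.single u 1"

definition mdegree :: "('n::finite \<Rightarrow>\<^sub>0 nat) \<Rightarrow> nat" where
  "mdegree u = (\<Sum>i\<in>UNIV. Poly_Mapping.lookup u i)"

definition monomial_ideal :: "('n::finite, 'k::field) mpoly set \<Rightarrow> bool" where
  "monomial_ideal I \<longleftrightarrow> (\<exists>A. I = ideal.span (monomial ` A))"

definition is_min_monomial_gens ::
    "('n::finite, 'k::field) mpoly set \<Rightarrow> ('n \<Rightarrow>\<^sub>0 nat) set \<Rightarrow> bool" where
  "is_min_monomial_gens I A \<longleftrightarrow>
     ideal.span (monomial ` A) = I \<and> (\<forall>B. B \<subset> A \<longrightarrow> ideal.span (monomial ` B) \<noteq> I)"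

text \<open>
  The set $G(I)$, given by exponent vectors. It is well defined for every monomial ideal by
  \<open>ex1_min_monomial_gens\<close> below.
\<close>

definition min_monomial_gens :: "('n::finite, 'k::field) mpoly set \<Rightarrow> ('n \<Rightarrow>\<^sub>0 nat) set" where
  "min_monomial_gens I = (THE A. is_min_monomial_gens I A)"

text \<open>
  The exponent vector of $x_j(u/x_i)$ is \<open>u - single i 1 + single j 1\<close>; the truncated subtraction
  is exact there because \<open>\<nu>\<^sub>i(u) > \<nu>\<^sub>i(v) \<ge> 0\<close>.
\<close>

definition polymatroidal :: "('n::finite, 'k::field) mpoly set \<Rightarrow> bool" where
  "polymatroidal I \<longleftrightarrow>
     monomial_ideal I \<and>
     (\<forall>u\<in>min_monomial_gens I. \<forall>v\<in>min_monomial_gens I. mdegree u = mdegree v) \<and>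
     (\<forall>u\<in>min_monomial_gens I. \<forall>v\<in>min_monomial_gens I. \<forall>i.
        Poly_Mapping.lookup u i > Poly_Mapping.lookup v i \<longrightarrow>
        (\<exists>j. Poly_Mapping.lookup v j > Poly_Mapping.lookup u j \<and>
             u - Poly_Mapping.single i 1 + Poly_Mapping.single j 1 \<in> min_monomial_gens I))"

lemma monomial_in_span_iff:
  "(monomial u :: ('n::finite, 'k::field) mpoly) \<in> ideal.span (monomial ` A) \<longleftrightarrow>
   (\<exists>a\<in>A. \<exists>c. u = a + c)"
proof
  let ?S = "{f :: ('n, 'k) mpoly. \<forall>w\<in>Poly_Mapping.keys f. \<exists>a\<in>A. \<exists>c. w = a + c}"
  assume "(monomial u :: ('n, 'k) mpoly) \<in> ideal.span (monomial ` A)"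
  moreover have "ideal.span (monomial ` A) \<subseteq> ?S"
  proof (rule ideal.span_minimal)
    show "monomial ` A \<subseteq> ?S"
      by (auto simp: monomial_def intro!: bexI exI[of _ 0])
    show "ideal.subspace ?S"
    proof (rule ideal.subspaceI)
      fix x y :: "('n, 'k) mpoly"
      assume "x \<in> ?S" "y \<in> ?S"
      then show "x + y \<in> ?S"
        using Poly_Mapping.keys_add[of x y] by blast
    next
      fix c x :: "('n, 'k) mpoly"
      assume x: "x \<in> ?S"
      show "c * x \<in> ?S"
      proof (clarify)
        fix w assume "w \<in> Poly_Mapping.keys (c * x)"
        then obtain p q where "w = p + q" "q \<in> Poly_Mapping.keys x"
          using keys_mult[of c x] by blast
        moreover from this x obtain a d where "a \<in> A" "q = a + d" by blast
        ultimately have "a \<in> A" "w = a + (p + d)" by (simp_all add: ac_simps)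
        then show "\<exists>a\<in>A. \<exists>c. w = a + c" by blast
      qed
    qed simp
  qed
  ultimately show "\<exists>a\<in>A. \<exists>c. u = a + c"
    by (auto simp: monomial_def)
next
  assume "\<exists>a\<in>A. \<exists>c. u = a + c"
  then obtain a c where "a \<in> A" "u = a + c" by blast
  then have "(monomial u :: ('n, 'k) mpoly) = monomial c * monomial a"
    by (simp add: monomial_def mult_single add.commute)
  then show "(monomial u :: ('n, 'k) mpoly) \<in> ideal.span (monomial ` A)"
    using \<open>a \<in> A\<close> by (simp add: ideal.span_base ideal.span_scale)
qed

lemma mdegree_add: "mdegree (u + v) = mdegree u + mdegree v"
  by (simp add: mdegree_def lookup_add sum.distrib)

lemma mdegree_eq_0_iff: "mdegree u = 0 \<longleftrightarrow> u = 0"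
  by (auto simp: mdegree_def intro: poly_mapping_eqI)

lemma ex1_min_monomial_gens:
  fixes I :: "('n::finite, 'k::field) mpoly set"
  assumes "monomial_ideal I"
  shows "\<exists>!A. is_min_monomial_gens I A"
proof -
  define m :: "('n \<Rightarrow>\<^sub>0 nat) \<Rightarrow> ('n, 'k) mpoly" where "m = monomial"
  define M where "M = {u. m u \<in> I \<and> (\<forall>a c. u = a + c \<longrightarrow> m a \<in> I \<longrightarrow> c = 0)}"
  obtain A0 where A0: "I = ideal.span (m ` A0)"
    using assms by (auto simp: monomial_ideal_def m_def)
  have in_span: "m u \<in> ideal.span (m ` A) \<longleftrightarrow> (\<exists>a\<in>A. \<exists>c. u = a + c)" for u A
    unfolding m_def by (rule monomial_in_span_iff)
  have sub: "M \<subseteq> A" if A: "ideal.span (m ` A) = I" for A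
  proof
    fix u assume u: "u \<in> M"
    then obtain a c where ac: "a \<in> A" "u = a + c"
      using in_span[of u A] A by (auto simp: M_def)
    have "m a \<in> I" using ac A ideal.span_base by blast
    then have "c = 0" using u ac by (auto simp: M_def)
    then show "u \<in> A" using ac by simp
  qed
  have div: "\<exists>a\<in>M. \<exists>c. u = a + c" if "m u \<in> I" for u
    using that
  proof (induction "mdegree u" arbitrary: u rule: less_induct)
    case less
    show ?case
    proof (cases "u \<in> M")
      case True
      then show ?thesis by (metis add.right_neutral)
    next
      case False
      then obtain a c where ac: "u = a + c" "m a \<in> I" "c \<noteq> 0"
        using less.prems by (auto simp: M_def)
      then have "mdegree a < mdegree u"
        using mdegree_eq_0_iff[of c] by (simp add: mdegree_add)
      from less.hyps[OF this ac(2)] show ?thesis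
        unfolding ac(1) by (metis add.assoc)
    qed
  qed
  have gen: "ideal.span (m ` M) = I"
  proof
    show "ideal.span (m ` M) \<subseteq> I"
      unfolding A0 by (rule ideal.span_minimal) (auto simp: M_def A0)
    have "m u \<in> ideal.span (m ` M)" if "u \<in> A0" for u
    proof -
      have "m u \<in> I" using that unfolding A0 by (simp add: ideal.span_base)
      then show ?thesis using div in_span by blast
    qed
    then show "I \<subseteq> ideal.span (m ` M)"
      unfolding A0 by (intro ideal.span_minimal) auto
  qed
  show ?thesis
  proof
    show "is_min_monomial_gens I M"
      using gen sub by (auto simp: is_min_monomial_gens_def m_def)
    show "A = M" if "is_min_monomial_gens I A" for A
      using that gen sub[of A] by (auto simp: is_min_monomial_gens_def m_def)
  qed
qed

end

theory Submission
  imports Defs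
begin

text \<open>
  The proof has an algebraic and a combinatorial half.

  Algebraically, $G(IJ)$ is the Minkowski sum $G(I) + G(J)$ of sets of exponent vectors: products
  of generators generate a product of ideals (\<open>ideal_prod_span\<close>), and a set of monomials of one
  fixed degree is always a minimal generating set, because none of them properly divides another
  (\<open>min_monomial_gens_span\<close>).

  Combinatorially, the exchange property passes to Minkowski sums (\<open>exchange_property_sum\<close>).
  Let $u = a + b$ and $v = a' + b'$ with $u_i > v_i$, and put $p = u - e_i$. The argument follows
  a token $k$, starting at $k = i$, through decompositions $p + e_k = a + b$. If $v_k > u_k$, then
  $k$ is the index sought. Otherwise $(p + e_k)_k > v_k$, so that $a_k > a'_k$ or $b_k > b'_k$;
  an exchange in that summand alone replaces $e_k$ by some $e_j$, which moves the token from
  $k$ to $j$ and reduces the excess of the summand over its target $a'$ or $b'$. The token may revisit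
  indices, even $i$ itself, but the total excess over $(a', b')$ drops at each move, so it
  must stop.
\<close>

section \<open>Generators of a product of monomial ideals\<close>

lemma ideal_prod_span:
  fixes S T :: "'a::comm_ring_1 set"
  shows "ideal_prod (ideal.span S) (ideal.span T) = ideal.span {s * t | s t. s \<in> S \<and> t \<in> T}"
    (is "_ = ideal.span ?P")
proof
  have right: "s * g \<in> ideal.span ?P" if "s \<in> S" "g \<in> ideal.span T" for s g
  proof -
    have "ideal.span T \<subseteq> {g. s * g \<in> ideal.span ?P}"
    proof (rule ideal.span_minimal)
      show "T \<subseteq> {g. s * g \<in> ideal.span ?P}"
        using that(1) by (auto intro!: ideal.span_base)
      show "ideal.subspace {g. s * g \<in> ideal.span ?P}"
      proof (rule ideal.subspaceI)
        fix c g assume "g \<in> {g. s * g \<in> ideal.span ?P}"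
        then have "c * (s * g) \<in> ideal.span ?P"
          by (blast intro: ideal.span_scale)
        then show "c * g \<in> {g. s * g \<in> ideal.span ?P}"
          by (simp only: mem_Collect_eq mult.left_commute)
      qed (simp_all add: ideal.span_zero distrib_left ideal.span_add)
    qed
    with that(2) show ?thesis by blast
  qed
  have both: "f * g \<in> ideal.span ?P" if "f \<in> ideal.span S" "g \<in> ideal.span T" for f g
  proof -
    have "ideal.span S \<subseteq> {f. f * g \<in> ideal.span ?P}"
    proof (rule ideal.span_minimal)
      show "S \<subseteq> {f. f * g \<in> ideal.span ?P}"
        using right that(2) by blast
      show "ideal.subspace {f. f * g \<in> ideal.span ?P}"
      proof (rule ideal.subspaceI)
        fix c f assume "f \<in> {f. f * g \<in> ideal.span ?P}"
        then have "c * (f * g) \<in> ideal.span ?P"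
          by (blast intro: ideal.span_scale)
        then show "c * f \<in> {f. f * g \<in> ideal.span ?P}"
          by (simp only: mem_Collect_eq mult.assoc)
      qed (simp_all add: ideal.span_zero distrib_right ideal.span_add)
    qed
    with that(1) show ?thesis by blast
  qed
  show "ideal_prod (ideal.span S) (ideal.span T) \<subseteq> ideal.span ?P"
    unfolding ideal_prod_def by (rule ideal.span_minimal) (auto intro: both)
  show "ideal.span ?P \<subseteq> ideal_prod (ideal.span S) (ideal.span T)"
    unfolding ideal_prod_def by (rule ideal.span_mono) (blast intro: ideal.span_base)
qed

lemma monomial_add: "monomial (u + v) = monomial u * monomial v"
  by (simp add: monomial_def mult_single)

lemma ideal_prod_span_monomials:
  "ideal_prod (ideal.span (monomial ` A)) (ideal.span (monomial ` B)) =
   ideal.span (monomial ` {a + b | a b. a \<in> A \<and> b \<in> B} :: ('n::finite, 'k::field) mpoly set)"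
proof -
  have "{s * t | s t. s \<in> monomial ` A \<and> t \<in> monomial ` B} =
        (monomial ` {a + b | a b. a \<in> A \<and> b \<in> B} :: ('n, 'k) mpoly set)"
  proof (intro subset_antisym subsetI)
    fix f :: "('n, 'k) mpoly"
    assume "f \<in> {s * t | s t. s \<in> monomial ` A \<and> t \<in> monomial ` B}"
    then obtain a b where "a \<in> A" "b \<in> B" "f = monomial a * monomial b"
      by blast
    then show "f \<in> monomial ` {a + b | a b. a \<in> A \<and> b \<in> B}"
      unfolding monomial_add[symmetric] by blast
  next
    fix f :: "('n, 'k) mpoly"
    assume "f \<in> monomial ` {a + b | a b. a \<in> A \<and> b \<in> B}"
    then obtain a b where "a \<in> A" "b \<in> B" "f = monomial a * monomial b"
      by (auto simp only: monomial_add)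
    then show "f \<in> {s * t | s t. s \<in> monomial ` A \<and> t \<in> monomial ` B}"
      by blast
  qed
  then show ?thesis
    by (simp only: ideal_prod_span)
qed

lemma span_min_monomial_gens:
  assumes "monomial_ideal I"
  shows "ideal.span (monomial ` min_monomial_gens I) = I"
proof -
  have "is_min_monomial_gens I (min_monomial_gens I)"
    unfolding min_monomial_gens_def by (rule theI'[OF ex1_min_monomial_gens[OF assms]])
  then show ?thesis
    unfolding is_min_monomial_gens_def by (rule conjunct1)
qed

text \<open>
  Among monomials of equal degree divisibility is equality, so a monomial left out of the
  generating set cannot be recovered from the others.
\<close>

lemma min_monomial_gens_span:
  fixes A :: "('n::finite \<Rightarrow>\<^sub>0 nat) set"
  assumes deg: "\<And>u v. u \<in> A \<Longrightarrow> v \<in> A \<Longrightarrow> mdegree u = mdegree v"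
  shows "min_monomial_gens (ideal.span (monomial ` A) :: ('n, 'k::field) mpoly set) = A"
proof -
  let ?I = "ideal.span (monomial ` A) :: ('n, 'k) mpoly set"
  have "is_min_monomial_gens ?I A"
    unfolding is_min_monomial_gens_def
  proof (intro conjI allI impI notI)
    fix B assume "B \<subset> A" and span: "ideal.span (monomial ` B) = ?I"
    then obtain u where u: "u \<in> A" "u \<notin> B" by blast
    have "(monomial u :: ('n, 'k) mpoly) \<in> ideal.span (monomial ` B)"
      unfolding span using u(1) by (simp add: ideal.span_base)
    then obtain b c where bc: "b \<in> B" "u = b + c"
      unfolding monomial_in_span_iff by blast
    with \<open>B \<subset> A\<close> have "b \<in> A" by blast
    with u(1) have "mdegree u = mdegree b" by (rule deg)
    with bc(2) have "c = 0"
      by (simp add: mdegree_add mdegree_eq_0_iff)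
    with bc u(2) show False by simp
  qed simp
  moreover have "monomial_ideal ?I"
    by (auto simp: monomial_ideal_def)
  ultimately show ?thesis
    unfolding min_monomial_gens_def by (intro the1_equality ex1_min_monomial_gens)
qed

section \<open>The exchange property and Minkowski sums\<close>

definition exchange_property :: "('n \<Rightarrow>\<^sub>0 nat) set \<Rightarrow> bool" where
  "exchange_property A \<longleftrightarrow>
     (\<forall>u\<in>A. \<forall>v\<in>A. \<forall>i. Poly_Mapping.lookup u i > Poly_Mapping.lookup v i \<longrightarrow>
        (\<exists>j. Poly_Mapping.lookup v j > Poly_Mapping.lookup u j \<and>
             u - Poly_Mapping.single i 1 + Poly_Mapping.single j 1 \<in> A))"

text \<open>
  The truncated difference \<open>a - a'\<close> measures how far \<open>a\<close> exceeds \<open>a'\<close>. An exchange towards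
  \<open>a'\<close> lowers it by one at \<open>k\<close> and leaves it zero at \<open>j\<close>, where \<open>a\<close> lay below \<open>a'\<close>.
  The exchanged vector is written without subtraction, which lets the token argument
  cancel the unit vectors in a sum.
\<close>

lemma exchange_property_closer:
  fixes A :: "('n::finite \<Rightarrow>\<^sub>0 nat) set"
  assumes "exchange_property A" "a \<in> A" "a' \<in> A"
    and "Poly_Mapping.lookup a k > Poly_Mapping.lookup a' k"
  obtains c j where "c \<in> A"
    and "c + Poly_Mapping.single k 1 = a + Poly_Mapping.single j 1"
    and "mdegree (c - a') < mdegree (a - a')"
proof -
  obtain j where j: "Poly_Mapping.lookup a' j > Poly_Mapping.lookup a j"
    and c: "a - Poly_Mapping.single k 1 + Poly_Mapping.single j 1 \<in> A" (is "?c \<in> A")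
    using assms unfolding exchange_property_def by blast
  have move: "?c + Poly_Mapping.single k 1 = a + Poly_Mapping.single j 1"
    using assms(4)
    by (intro poly_mapping_eqI) (auto simp: lookup_add lookup_minus lookup_single when_def)
  have "a - a' = (?c - a') + Poly_Mapping.single k 1"
    using assms(4) j
    by (intro poly_mapping_eqI) (auto simp: lookup_add lookup_minus lookup_single when_def)
  then have "mdegree (a - a') = mdegree (?c - a') + mdegree (Poly_Mapping.single k 1)"
    by (simp only: mdegree_add)
  moreover have "mdegree (Poly_Mapping.single k 1) = 1"
    by (simp add: mdegree_def lookup_single when_def)
  ultimately have "mdegree (?c - a') < mdegree (a - a')"
    by linarith
  with c move show thesis
    by (rule that)
qed

text \<open>
  Each exchange moves the token \<open>k\<close> and lowers the total excess of \<open>(a, b)\<close> over \<open>(a', b')\<close>,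
  so induction on that excess applies. The hypothesis on \<open>p\<close> says that adding a unit vector at an index where
  \<open>u\<close> is not below \<open>v\<close> pushes \<open>p\<close> above \<open>v\<close> there, so that the token can be moved on; for
  $p = u - e_i$ it follows from $u_i > v_i$.
\<close>

lemma exchange_token_stops:
  fixes A B :: "('n::finite \<Rightarrow>\<^sub>0 nat) set"
  assumes "exchange_property A" "exchange_property B"
    and "a' \<in> A" "b' \<in> B" "v = a' + b'"
    and p: "\<And>k. Poly_Mapping.lookup v k \<le> Poly_Mapping.lookup u k \<Longrightarrow>
              Poly_Mapping.lookup v k \<le> Poly_Mapping.lookup p k"
    and "a \<in> A" "b \<in> B" "a + b = p + Poly_Mapping.single k 1"
  shows "\<exists>j. Poly_Mapping.lookup v j > Poly_Mapping.lookup u j \<and>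
             p + Poly_Mapping.single j 1 \<in> {a + b | a b. a \<in> A \<and> b \<in> B}"
  using assms(7-9)
proof (induction "mdegree (a - a') + mdegree (b - b')" arbitrary: a b k rule: less_induct)
  case less
  show ?case
  proof (cases "Poly_Mapping.lookup v k > Poly_Mapping.lookup u k")
    case True
    moreover have "p + Poly_Mapping.single k 1 \<in> {a + b | a b. a \<in> A \<and> b \<in> B}"
      unfolding less.prems(3)[symmetric] using less.prems(1,2) by blast
    ultimately show ?thesis by blast
  next
    case False
    then have "Poly_Mapping.lookup v k < Poly_Mapping.lookup (a + b) k"
      unfolding less.prems(3) using p[of k] by (simp add: lookup_add)
    then consider "Poly_Mapping.lookup a' k < Poly_Mapping.lookup a k"
      | "Poly_Mapping.lookup b' k < Poly_Mapping.lookup b k"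
      unfolding assms(5) lookup_add by linarith
    then show ?thesis
    proof cases
      case 1
      then obtain c j where c: "c \<in> A"
        "c + Poly_Mapping.single k 1 = a + Poly_Mapping.single j 1"
        "mdegree (c - a') < mdegree (a - a')"
        by (rule exchange_property_closer[OF assms(1) less.prems(1) assms(3)])
      have "(c + b) + Poly_Mapping.single k 1 = (c + Poly_Mapping.single k 1) + b"
        by (simp only: add_ac)
      also have "\<dots> = (a + b) + Poly_Mapping.single j 1"
        unfolding c(2) by (simp only: add_ac)
      also have "\<dots> = (p + Poly_Mapping.single j 1) + Poly_Mapping.single k 1"
        unfolding less.prems(3) by (simp only: add_ac)
      finally have "c + b = p + Poly_Mapping.single j 1"
        by (rule add_right_imp_eq)
      with c(3) show ?thesis
        by (intro less.hyps[OF _ c(1) less.prems(2)]) (rule add_strict_right_mono)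
    next
      case 2
      then obtain c j where c: "c \<in> B"
        "c + Poly_Mapping.single k 1 = b + Poly_Mapping.single j 1"
        "mdegree (c - b') < mdegree (b - b')"
        by (rule exchange_property_closer[OF assms(2) less.prems(2) assms(4)])
      have "(a + c) + Poly_Mapping.single k 1 = a + (c + Poly_Mapping.single k 1)"
        by (simp only: add_ac)
      also have "\<dots> = (a + b) + Poly_Mapping.single j 1"
        unfolding c(2) by (simp only: add_ac)
      also have "\<dots> = (p + Poly_Mapping.single j 1) + Poly_Mapping.single k 1"
        unfolding less.prems(3) by (simp only: add_ac)
      finally have "a + c = p + Poly_Mapping.single j 1"
        by (rule add_right_imp_eq)
      with c(3) show ?thesis
        by (intro less.hyps[OF _ less.prems(1) c(1)]) (rule add_strict_left_mono)
    qed
  qed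
qed

lemma exchange_property_sum:
  fixes A B :: "('n::finite \<Rightarrow>\<^sub>0 nat) set"
  assumes "exchange_property A" "exchange_property B"
  shows "exchange_property {a + b | a b. a \<in> A \<and> b \<in> B}" (is "exchange_property ?C")
  unfolding exchange_property_def
proof (intro ballI allI impI)
  fix u v i assume "u \<in> ?C" "v \<in> ?C" and i: "Poly_Mapping.lookup u i > Poly_Mapping.lookup v i"
  then obtain a b a' b' where ab: "a \<in> A" "b \<in> B" "u = a + b"
    and ab': "a' \<in> A" "b' \<in> B" "v = a' + b'"
    by blast
  let ?p = "u - Poly_Mapping.single i 1"
  have p: "Poly_Mapping.lookup v k \<le> Poly_Mapping.lookup ?p k"
    if "Poly_Mapping.lookup v k \<le> Poly_Mapping.lookup u k" for k
    using that i by (auto simp: lookup_minus lookup_single when_def)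
  have "a + b = ?p + Poly_Mapping.single i 1"
    unfolding ab(3)[symmetric] using i
    by (intro poly_mapping_eqI) (auto simp: lookup_add lookup_minus lookup_single when_def)
  from exchange_token_stops[OF assms ab' p ab(1,2) this]
  show "\<exists>j. Poly_Mapping.lookup v j > Poly_Mapping.lookup u j \<and> ?p + Poly_Mapping.single j 1 \<in> ?C" .
qed

section \<open>Products of polymatroidal ideals\<close>

lemma polymatroidal_altdef:
  "polymatroidal I \<longleftrightarrow>
     monomial_ideal I \<and>
     (\<forall>u\<in>min_monomial_gens I. \<forall>v\<in>min_monomial_gens I. mdegree u = mdegree v) \<and>
     exchange_property (min_monomial_gens I)"
  by (simp only: polymatroidal_def exchange_property_def)

theorem theorem5p3:
  fixes I J :: "('n::finite, 'k::field) mpoly set"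
  assumes "polymatroidal I" and "polymatroidal J"
  shows "polymatroidal (ideal_prod I J)"
proof -
  let ?C = "{a + b | a b. a \<in> min_monomial_gens I \<and> b \<in> min_monomial_gens J}"
  have deg: "mdegree u = mdegree v" if uv: "u \<in> ?C" "v \<in> ?C" for u v
  proof -
    obtain a b a' b' where "u = a + b" "v = a' + b'"
      and "a \<in> min_monomial_gens I" "a' \<in> min_monomial_gens I"
      and "b \<in> min_monomial_gens J" "b' \<in> min_monomial_gens J"
      using uv by blast
    moreover from this assms have "mdegree a = mdegree a'" "mdegree b = mdegree b'"
      unfolding polymatroidal_def by blast+
    ultimately show ?thesis
      by (simp add: mdegree_add)
  qed
  have "ideal_prod I J = ideal_prod (ideal.span (monomial ` min_monomial_gens I))
                                    (ideal.span (monomial ` min_monomial_gens J))"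
    using assms by (simp add: polymatroidal_altdef span_min_monomial_gens)
  also have "\<dots> = ideal.span (monomial ` ?C)"
    by (rule ideal_prod_span_monomials)
  finally have prod: "ideal_prod I J = ideal.span (monomial ` ?C)" .
  have gens: "min_monomial_gens (ideal_prod I J) = ?C"
    unfolding prod by (rule min_monomial_gens_span) (rule deg)
  have "exchange_property ?C"
    using assms by (intro exchange_property_sum) (simp_all add: polymatroidal_altdef)
  moreover have "monomial_ideal (ideal_prod I J)"
    using prod unfolding monomial_ideal_def by blast
  ultimately show ?thesis
    unfolding polymatroidal_altdef gens using deg by blast
qed

end
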